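(* The following (equivalent) identities hold in $\mathbb Q(v)$ for every $p\in\mathbb N$: $$[p]!\sum_{\substack{k,m\in\mathbb N\\k+m=p}}\frac{v^{-2(k-1)m-\frac{p(3-p)}2}}{[2k]^{!!}[2m]^{!!}}=1,$$ $$\sum_{k=0}^pv^{\frac{p(p+1)}2-2k(p-k+1)}\begin{bmatrix}p\\k\end{bmatrix}_{v^2}=\frac{[2p]^{!!}}{[p]!}.$$
   Context: $v$ is an indeterminate and $\mathbb N=\{0,1,2,\dots\}$. $[n]=\frac{v^n-v^{-n}}{v-v^{-1}}$, $[n]!=\prod_{s=1}^n[s]$, $[0]^{!!}=1$, $[2l]^{!!}=[2l][2l-2]\cdots[2]$. $\begin{bmatrix}p\\k\end{bmatrix}=\frac{[p][p-1]\cdots[p-k+1]}{[k]!}$, and $\begin{bmatrix}p\\k\end{bmatrix}_{v^2}$ is obtained from it by replacing $v$ with $v^2$. *)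

theory Defs
  imports "HOL-Computational_Algebra.Computational_Algebra"
begin

text \<open>The field \<open>\<rat>(v)\<close> is \<^typ>\<open>rat poly fract\<close>, with the following indeterminate.\<close>

definition vq :: "rat poly fract" where
  "vq = Fract [:0, 1:] 1"

text \<open>The quantum numbers carry their base \<open>q\<close> as an argument, so that the subscript \<open>v\<^sup>2\<close>
  (replacing \<open>v\<close> by \<open>v\<^sup>2\<close>) means instantiating \<open>q\<close> with the square of the indeterminate.\<close>

definition qint :: "'a::field \<Rightarrow> int \<Rightarrow> 'a" where
  "qint q n = (q powi n - q powi (- n)) / (q - q powi (- 1))"

definition qfact :: "'a::field \<Rightarrow> nat \<Rightarrow> 'a" where
  "qfact q n = (\<Prod>s=1..n. qint q (int s))"

text \<open>\<open>qdfact q l\<close> is \<open>[2l]!!\<close>: the argument is half of the number in the brackets.\<close>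

definition qdfact :: "'a::field \<Rightarrow> nat \<Rightarrow> 'a" where
  "qdfact q l = (\<Prod>s=1..l. qint q (2 * int s))"

definition qbinom :: "'a::field \<Rightarrow> int \<Rightarrow> nat \<Rightarrow> 'a" where
  "qbinom q p k = (\<Prod>i<k. qint q (p - int i)) / qfact q k"

end

theory Submission
  imports Defs
begin

text \<open>
  Put \<open>Q = v\<^sup>-\<^sup>2\<close> and \<open>a\<^sub>k = \<Prod>s=1..k. 1 / (1 - Q\<^sup>2\<^sup>s)\<close>. Clearing powers of \<open>v\<close>, the first identity
  says that \<open>B\<^sub>n = \<Sum>k\<le>n. a\<^sub>k a\<^sub>n\<^sub>-\<^sub>k Q\<^sup>k\<close> equals \<open>\<Prod>s=1..n. 1 / (1 - Q\<^sup>s)\<close>, that is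
  \<open>(1 - Q\<^sup>n) B\<^sub>n = B\<^sub>n\<^sub>-\<^sub>1\<close>. Writing \<open>Q\<^sup>n Q\<^sup>k = Q\<^sup>2\<^sup>k Q\<^sup>n\<^sup>-\<^sup>k\<close> and \<open>(1 - Q\<^sup>2\<^sup>k) a\<^sub>k = a\<^sub>k\<^sub>-\<^sub>1\<close>, this is
  the symmetry \<open>k \<leftrightarrow> n - k\<close> of the sum. The second identity is the first one multiplied by
  \<open>[2p]!! / [p]!\<close>.
\<close>

text \<open>The q-Pochhammer symbol (q;q)_n, so replacing \<open>q\<close> by its square gives
  (q^2;q^2)_n.\<close>

definition qpoch :: "'a::field \<Rightarrow> nat \<Rightarrow> 'a" where
  "qpoch q n = (\<Prod>s=1..n. 1 - q ^ s)"

lemma qpoch_0 [simp]: "qpoch q 0 = 1"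
  by (simp add: qpoch_def)

lemma qpoch_Suc [simp]: "qpoch q (Suc n) = qpoch q n * (1 - q ^ Suc n)"
  by (simp add: qpoch_def)

lemma qpoch_nonzero:
  assumes "\<And>n. n > 0 \<Longrightarrow> q ^ n \<noteq> 1"
  shows "qpoch q n \<noteq> 0"
  using assms by (fastforce simp: qpoch_def)

text \<open>Formally, this compares coefficients of x^n in 1/(x;q)_inf = 1/((x;q^2)_inf
  (xq;q^2)_inf). The proof uses the recurrence \<open>B_Suc\<close> instead.\<close>

lemma sum_qpoch_square:
  fixes q :: "'a::field"
  assumes q: "\<And>n. n > 0 \<Longrightarrow> q ^ n \<noteq> 1"
  shows "(\<Sum>k\<le>n. q ^ k / (qpoch (q\<^sup>2) k * qpoch (q\<^sup>2) (n - k))) = 1 / qpoch q n"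
proof -
  define a where "a k = 1 / qpoch (q\<^sup>2) k" for k
  define B where "B n = (\<Sum>k\<le>n. q ^ k * a k * a (n - k))" for n
  have q2: "(q\<^sup>2) ^ n \<noteq> 1" if "n > 0" for n
    using q[of "2 * n"] that by (simp add: power_mult)
  have a_Suc: "(1 - q ^ (2 * Suc k)) * a (Suc k) = a k" for k
    using q2[of "Suc k"] unfolding a_def qpoch_Suc power_mult by simp
  have B_flip: "B n = (\<Sum>k\<le>n. q ^ (n - k) * a k * a (n - k))" for n
    unfolding B_def by (rule sum.reindex_bij_witness[where i = "\<lambda>k. n - k" and j = "\<lambda>k. n - k"]) auto
  have B_Suc: "(1 - q ^ Suc n) * B (Suc n) = B n" for n
  proof -
    have "q ^ Suc n * B (Suc n) =
        (\<Sum>k\<le>Suc n. q ^ (Suc n - k) * (q ^ (2 * k) * a k) * a (Suc n - k))"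
      unfolding B_def sum_distrib_left
    proof (intro sum.cong refl)
      fix k assume "k \<in> {..Suc n}"
      then have "Suc n + k = (Suc n - k) + 2 * k"
        by simp
      then have "q ^ Suc n * q ^ k = q ^ (Suc n - k) * q ^ (2 * k)"
        unfolding power_add [symmetric] by (rule arg_cong)
      then show "q ^ Suc n * (q ^ k * a k * a (Suc n - k)) =
          q ^ (Suc n - k) * (q ^ (2 * k) * a k) * a (Suc n - k)"
        by (simp only: mult.assoc [symmetric])
    qed
    \<comment> \<open>Subtracting from the flipped form of \<open>B (Suc n)\<close> gives both sums
      the same weight.\<close>
    then have "(1 - q ^ Suc n) * B (Suc n) =
        (\<Sum>k\<le>Suc n. q ^ (Suc n - k) * ((1 - q ^ (2 * k)) * a k) * a (Suc n - k))"
      by (simp add: B_flip algebra_simps sum_subtractf del: power_Suc sum.atMost_Suc)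
    \<comment> \<open>The term k = 0 vanishes because 1 - q^0 = 0; by \<open>a_Suc\<close> the
      shifted rest is the flipped form of \<open>B n\<close>.\<close>
    also have "\<dots> = B n"
      unfolding sum.atMost_Suc_shift a_Suc by (simp add: B_flip)
    finally show ?thesis .
  qed
  have "B n = 1 / qpoch q n"
  proof (induction n)
    case 0
    then show ?case by (simp add: B_def a_def)
  next
    case (Suc n)
    have "1 - q ^ Suc n \<noteq> 0"
      using q[of "Suc n"] by simp
    then have "B (Suc n) = B n / (1 - q ^ Suc n)"
      using B_Suc[of n] by (metis nonzero_mult_div_cancel_left)
    then show ?case
      using Suc by simp
  qed
  then show ?thesis
    by (simp add: B_def a_def)
qed

text \<open>Factoring out q^n leaves only powers of q^-2, the base of the Pochhammer symbols below.
  If q = q^-1, both sides are 0 by division by zero.\<close>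

lemma qint_eq:
  fixes q :: "'a::field"
  assumes "q \<noteq> 0"
  shows "qint q (int n) = q ^ n * (1 - inverse (q\<^sup>2) ^ n) / (q - inverse q)"
proof -
  have "q ^ n * inverse (q\<^sup>2) ^ n = inverse q ^ n"
    using assms by (simp add: power2_eq_square power_mult_distrib field_simps)
  then show ?thesis
    by (simp add: qint_def power_int_minus right_diff_distrib power_inverse)
qed

lemma qfact_eq:
  fixes q :: "'a::field"
  assumes "q \<noteq> 0"
  shows "qfact q n = q ^ (\<Sum>s=1..n. s) * qpoch (inverse (q\<^sup>2)) n / (q - inverse q) ^ n"
  by (simp add: qfact_def qpoch_def qint_eq[OF assms] prod_dividef prod.distrib power_sum)

text \<open>Even indices 2s turn (q^-2)^(2s) into the s-th power of q^-4, hence the squared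
  base.\<close>

lemma qdfact_eq:
  fixes q :: "'a::field"
  assumes "q \<noteq> 0"
  shows "qdfact q n = q ^ (n * (n + 1)) * qpoch ((inverse (q\<^sup>2))\<^sup>2) n / (q - inverse q) ^ n"
proof -
  have "qdfact q n = (\<Prod>s=1..n. qint q (int (2 * s)))"
    by (simp add: qdfact_def)
  also have "\<dots> = q ^ (\<Sum>s=1..n. 2 * s) * qpoch ((inverse (q\<^sup>2))\<^sup>2) n / (q - inverse q) ^ n"
    unfolding qint_eq[OF assms] qpoch_def
    by (simp add: prod_dividef prod.distrib power_sum power_mult)
  also have "(\<Sum>s=1..n. 2 * s) = n * (n + 1)"
    by (induction n) auto
  finally show ?thesis .
qed

lemma qdfact_convolution:
  fixes v :: "'a::field"
  assumes v0: "v \<noteq> 0" and v: "\<And>n. n > 0 \<Longrightarrow> v ^ n \<noteq> 1"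
  shows "qfact v p * (\<Sum>k\<le>p. v powi (int p * (int p + 1) div 2 - 2 * int k * (int (p - k) + 1))
    / (qdfact v k * qdfact v (p - k))) = 1"
proof -
  define q where "q = inverse (v\<^sup>2)"
  define d where "d = v - inverse v"
  \<comment> \<open>\<open>T\<close> is p(p+1)/2, in the form in which \<open>qfact_eq\<close>
    produces it.\<close>
  define T where "T = (\<Sum>s=1..p. s)"
  have T: "int p * (int p + 1) = 2 * int T"
    unfolding T_def by (induction p) (auto simp: algebra_simps)
  have q: "q ^ n \<noteq> 1" if "n > 0" for n
    using v[of "2 * n"] that by (simp add: q_def power_mult power_inverse)
  have d: "d \<noteq> 0"
    using v[of 2] v0 by (auto simp: d_def field_simps power2_eq_square)
  have pq: "qpoch q n \<noteq> 0" for n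
    using q by (rule qpoch_nonzero)
  have pq2: "qpoch (q\<^sup>2) n \<noteq> 0" for n
    using q[of "2 * _"] by (intro qpoch_nonzero) (simp add: power_mult)
  \<comment> \<open>Separates the cancellation of nonzero factors from the exponent count: t, x, y,
    z will be powers of \<open>v\<close>, c will be \<open>q ^ k\<close>, and d1, d2 powers of
    \<open>d\<close>.\<close>
  have cancel: "t * P / (d1 * d2) * (x / ((y * A / d1) * (z * B / d2))) = P * (c / (A * B))"
    if "t * x = y * z * c" "d1 \<noteq> 0" "d2 \<noteq> 0" "A \<noteq> 0" "B \<noteq> 0" "y \<noteq> 0" "z \<noteq> 0"
    for t x y z c d1 d2 A B P :: 'a
  proof -
    have "t * P / (d1 * d2) * (x / ((y * A / d1) * (z * B / d2))) = P * (t * x) / (y * z * A * B)"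
      using that(2-) by (simp add: field_simps)
    then show ?thesis
      using that by simp
  qed
  have "qfact v p * (v powi (int p * (int p + 1) div 2 - 2 * int k * (int (p - k) + 1))
    / (qdfact v k * qdfact v (p - k))) =
      qpoch q p * (q ^ k / (qpoch (q\<^sup>2) k * qpoch (q\<^sup>2) (p - k)))" if "k \<le> p" for k
  proof -
    define m where "m = p - k"
    have p: "p = k + m"
      using that by (simp add: m_def)
    \<comment> \<open>With p = k + m, 2T = k(k+1) + m(m+1) + 2km; subtracting 2k(m+1) leaves the
      extra exponent -2k, which is the weight \<open>q ^ k\<close>.\<close>
    have e: "int T + (int T - 2 * int k * (int m + 1)) =
        int (k * (k + 1)) + int (m * (m + 1)) + - 2 * int k"
      using T by (simp add: p algebra_simps)
    have qk: "q ^ k = v powi (- 2 * int k)"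
      by (simp add: q_def power_int_minus power_inverse power_mult power_int_mult)
    have "v ^ T * v powi (int T - 2 * int k * (int m + 1)) =
        v powi (int T + (int T - 2 * int k * (int m + 1)))"
      using v0 by (simp only: power_int_add power_int_of_nat simp_thms)
    also have "\<dots> = v ^ (k * (k + 1)) * v ^ (m * (m + 1)) * q ^ k"
      unfolding e qk using v0 by (simp only: power_int_add power_int_of_nat simp_thms)
    finally have "v ^ T * v powi (int T - 2 * int k * (int m + 1)) =
        v ^ (k * (k + 1)) * v ^ (m * (m + 1)) * q ^ k" .
    from cancel[OF this, of "d ^ k" "d ^ m" "qpoch (q\<^sup>2) k" "qpoch (q\<^sup>2) m" "qpoch q p"]
    have "v ^ T * qpoch q p / d ^ p * (v powi (int T - 2 * int k * (int m + 1)) /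
          ((v ^ (k * (k + 1)) * qpoch (q\<^sup>2) k / d ^ k) *
           (v ^ (m * (m + 1)) * qpoch (q\<^sup>2) m / d ^ m))) =
        qpoch q p * (q ^ k / (qpoch (q\<^sup>2) k * qpoch (q\<^sup>2) m))"
      using v0 d pq2 by (simp only: p power_add) simp
    moreover have "int p * (int p + 1) div 2 = int T"
      using T by simp
    ultimately show ?thesis
      by (simp only: qfact_eq[OF v0] qdfact_eq[OF v0] m_def q_def d_def T_def)
  qed
  then have "qfact v p * (\<Sum>k\<le>p. v powi (int p * (int p + 1) div 2 - 2 * int k * (int (p - k) + 1))
      / (qdfact v k * qdfact v (p - k))) =
    qpoch q p * (\<Sum>k\<le>p. q ^ k / (qpoch (q\<^sup>2) k * qpoch (q\<^sup>2) (p - k)))"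
    unfolding sum_distrib_left by (intro sum.cong) auto
  also have "\<dots> = 1"
    using sum_qpoch_square[OF q] pq by simp
  finally show ?thesis .
qed

lemma qint_square:
  fixes q :: "'a::field"
  assumes "q - inverse q \<noteq> 0"
  shows "qint (q\<^sup>2) n = qint q (2 * n) / qint q 2"
  using assms by (simp add: qint_def power_int_mult power_int_minus power_inverse)

text \<open>By \<open>qint_square\<close>, numerator and denominator each carry k factors 1/[2],
  which cancel. The remaining product [2p]...[2(p-k+1)] is completed to [2p]!! by
  [2(p-k)]!!.\<close>

lemma qbinom_square:
  fixes v :: "'a::field"
  assumes v0: "v \<noteq> 0" and v: "\<And>n. n > 0 \<Longrightarrow> v ^ n \<noteq> 1" and "k \<le> p"
  shows "qbinom (v\<^sup>2) (int p) k = qdfact v p / (qdfact v k * qdfact v (p - k))"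
proof -
  have d: "v - inverse v \<noteq> 0"
    using v[of 2] v0 by (auto simp: field_simps power2_eq_square)
  \<comment> \<open>Up to nonzero factors, [2s] is 1 - v^(-4s), so this is the exponent at which
    \<open>v\<close> is used.\<close>
  have nz: "qint v (2 * int s) \<noteq> 0" if "s > 0" for s
    using qint_eq[OF v0, of "2 * s"] d v0 v[of "2 * (2 * s)"] that
    by (simp add: power_inverse power_mult)
  have nzd: "qdfact v n \<noteq> 0" for n
    by (simp add: qdfact_def nz)
  have nz2: "qint v 2 \<noteq> 0"
    using nz[of 1] by simp
  have num: "(\<Prod>i<k. qint v (2 * (int p - int i))) * qdfact v (p - k) = qdfact v p"
    using \<open>k \<le> p\<close>
  proof (induction k)
    case (Suc k)
    then have p: "p - k = Suc (p - Suc k)"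
      by simp
    have "qdfact v (p - k) = qdfact v (p - Suc k) * qint v (2 * (int p - int k))"
      unfolding p using Suc.prems by (simp add: qdfact_def of_nat_diff algebra_simps)
    then show ?case
      using Suc by (simp add: mult_ac)
  qed simp
  have "qbinom (v\<^sup>2) (int p) k = (\<Prod>i<k. qint v (2 * (int p - int i))) / qdfact v k"
    using nz2 by (simp add: qbinom_def qfact_def qdfact_def qint_square[OF d] prod_dividef)
  then show ?thesis
    using nzd by (simp add: num[symmetric])
qed

lemma vq_nonzero: "vq \<noteq> 0"
  by (simp add: vq_def Zero_fract_def eq_fract)

text \<open>The indeterminate is no root of unity: its n-th power is a polynomial of degree n > 0,
  while 1 has degree 0.\<close>

lemma vq_power_neq_1:
  assumes "n > 0"
  shows "vq ^ n \<noteq> 1"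
proof -
  have "vq ^ n = Fract ([:0, 1:] ^ n) 1"
    by (induction n) (simp_all add: vq_def One_fract_def)
  moreover have "degree ([:0, 1:] ^ n :: rat poly) \<noteq> degree (1 :: rat poly)"
    using assms by (simp add: degree_power_eq)
  ultimately show ?thesis
    by (auto simp: One_fract_def eq_fract)
qed

theorem lemma8p2:
  fixes p :: nat
  shows "qfact vq p *
      (\<Sum>(k, m)\<in>{(k, m). k + m = p}.
        vq powi (- 2 * (int k - 1) * int m - int p * (3 - int p) div 2)
          / (qdfact vq k * qdfact vq m)) = 1
    \<and> (\<Sum>k=0..p. vq powi (int p * (int p + 1) div 2 - 2 * int k * (int p - int k + 1))
          * qbinom (vq ^ 2) (int p) k)
      = qdfact vq p / qfact vq p"
proof
  define S where "S = (\<Sum>k\<le>p. vq powi (int p * (int p + 1) div 2 - 2 * int k * (int (p - k) + 1))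
    / (qdfact vq k * qdfact vq (p - k)))"
  have S: "qfact vq p * S = 1"
    unfolding S_def by (rule qdfact_convolution[OF vq_nonzero vq_power_neq_1])
  \<comment> \<open>Since p(3-p) = 4p - p(p+1) and p(p+1) is even, the integer division is exact,
    also for negative p(3-p). Then 2m - 2p = -2k matches the exponents.\<close>
  have e: "- 2 * (int k - 1) * int m - int p * (3 - int p) div 2 =
      int p * (int p + 1) div 2 - 2 * int k * (int m + 1)" if "k + m = p" for k m
  proof -
    have "int p * (3 - int p) = 2 * (2 * int p) - int p * (int p + 1)"
      by (simp add: algebra_simps)
    moreover have "even (int p * (int p + 1))"
      by simp
    ultimately have "int p * (3 - int p) div 2 = 2 * int p - int p * (int p + 1) div 2"
      by (elim evenE) simp
    then show ?thesis
      using that by (auto simp: algebra_simps)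
  qed
  have "(\<Sum>(k, m)\<in>{(k, m). k + m = p}.
        vq powi (- 2 * (int k - 1) * int m - int p * (3 - int p) div 2)
          / (qdfact vq k * qdfact vq m)) =
      (\<Sum>(k, m)\<in>{(k, m). k + m = p}.
        vq powi (int p * (int p + 1) div 2 - 2 * int k * (int m + 1))
          / (qdfact vq k * qdfact vq m))"
    by (intro sum.cong refl) (simp only: case_prod_beta mem_Collect_eq e)
  also have "\<dots> = S"
    unfolding S_def
    by (rule sum.reindex_bij_witness[where i = "\<lambda>k. (k, p - k)" and j = fst]) auto
  finally show "qfact vq p *
      (\<Sum>(k, m)\<in>{(k, m). k + m = p}.
        vq powi (- 2 * (int k - 1) * int m - int p * (3 - int p) div 2)
          / (qdfact vq k * qdfact vq m)) = 1"
    using S by (simp only:)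
  \<comment> \<open>By \<open>qbinom_square\<close>, each term is [2p]!! times the corresponding
    term of \<open>S\<close>.\<close>
  have "(\<Sum>k=0..p. vq powi (int p * (int p + 1) div 2 - 2 * int k * (int p - int k + 1))
          * qbinom (vq ^ 2) (int p) k) = qdfact vq p * S"
    unfolding S_def sum_distrib_left
    by (rule sum.cong)
      (auto simp: qbinom_square[OF vq_nonzero vq_power_neq_1] of_nat_diff)
  \<comment> \<open>The product being 1 also shows that [p]! is nonzero.\<close>
  also have "S = 1 / qfact vq p"
    using S by (auto simp: eq_divide_eq mult.commute)
  also have "qdfact vq p * (1 / qfact vq p) = qdfact vq p / qfact vq p"
    by simp
  finally show "(\<Sum>k=0..p. vq powi (int p * (int p + 1) div 2 - 2 * int k * (int p - int k + 1))
          * qbinom (vq ^ 2) (int p) k) = qdfact vq p / qfact vq p" .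
qed

end
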